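(* Let $\mathscr{P}=\{p_\theta:\theta\in\Theta\}$ be a probability model. Let $\rho$ be a metric (or pseudometric) on $\Theta$ and let the loss function be $\ell(\theta,\hat\theta)=\Phi(\rho(\theta,\hat\theta))$, where $\Phi:\mathbb{R}^+\to\mathbb{R}^+$ is nondecreasing with $\Phi(0)=0$. For any $\epsilon,\delta>0$, the minimax risk of estimating $\theta$ from $n$ i.i.d. samples is lower bounded as $$\mathscr{R}_n(\mathscr{P},\ell)\ge\Phi(\delta)\Big(1-\frac{\log K(\epsilon;\mathscr{P})+n\epsilon^2+1}{\log M(2\delta;\Theta,\rho)}\Big),$$ where $K(\epsilon;\mathscr{P})$ is the relative entropy $\epsilon$-covering number of the model class $\mathscr{P}$, and $M(2\delta;\Theta,\rho)$ is the packing number of the parameter space $\Theta$ at resolution $2\delta$.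
   Context: Each $p_\theta$ is a distribution on $\mathbb{R}^k$. An estimator is a function $\hat\theta:\mathbb{R}^{kn}\to\Theta$. Its risk is $R_n(\theta,\hat\theta)=\mathsf{E}(\ell(\theta,\hat\theta(\mathbf{X}^n)))$ with $\mathbf{X}^n=(\mathbf{X}_1,\ldots,\mathbf{X}_n)$ i.i.d. from $p_\theta$, and the minimax risk is $\mathscr{R}_n(\mathscr{P},\ell)=\inf_{\hat\theta}\sup_{\theta\in\Theta}R_n(\theta,\hat\theta)$. A set of distributions $\{q_1,\ldots,q_K\}$ is a relative entropy $\epsilon$-net of $\mathscr{P}$ if for every $p\in\mathscr{P}$ there is some $j$ with $D(p\|q_j)\le\epsilon^2$, where $D$ is relative entropy; $K(\epsilon;\mathscr{P})$ is the minimum $K$ such that there exists a relative entropy $\epsilon$-net of $\mathscr{P}$. The packing number $M(2\delta;\Theta,\rho)$ is the maximum $m$ such that there are $\theta_1,\ldots,\theta_m\in\Theta$ with $\rho(\theta_i,\theta_j)>2\delta$ for every $i\ne j$. Logarithms are to base 2 and relative entropy is in bits. $\mathbb{R}^+=[0,\infty)$. *)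

theory Defs
  imports "HOL-Probability.Probability" "HOL-Library.Extended_Nat" "HOL-Library.Extended_Real"
begin

definition pseudometric_on :: "'p set \<Rightarrow> ('p \<Rightarrow> 'p \<Rightarrow> real) \<Rightarrow> bool" where
  "pseudometric_on \<Theta> \<rho> \<longleftrightarrow>
     (\<forall>x\<in>\<Theta>. \<rho> x x = 0) \<and>
     (\<forall>x\<in>\<Theta>. \<forall>y\<in>\<Theta>. 0 \<le> \<rho> x y \<and> \<rho> x y = \<rho> y x) \<and>
     (\<forall>x\<in>\<Theta>. \<forall>y\<in>\<Theta>. \<forall>z\<in>\<Theta>. \<rho> x z \<le> \<rho> x y + \<rho> y z)"

lemma Metric_space_imp_pseudometric_on:
  "Metric_space \<Theta> \<rho> \<Longrightarrow> pseudometric_on \<Theta> \<rho>"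
  unfolding pseudometric_on_def Metric_space_def by blast

text \<open>
  Relative entropy \<open>D(P \<parallel> Q)\<close> in bits, for probability measures. The library's
  \<^const>\<open>KL_divergence\<close> takes the reference measure first and is real-valued, so it
  is only meaningful when \<open>P\<close> is absolutely continuous with respect to \<open>Q\<close> and the log-density
  is \<open>P\<close>-integrable. Since the negative part of the log-density is always integrable, failure
  of integrability means that the relative entropy is infinite.
\<close>
definition relative_entropy :: "'a measure \<Rightarrow> 'a measure \<Rightarrow> ereal" where
  "relative_entropy P Q =
     (if absolutely_continuous Q P \<and> integrable P (entropy_density 2 Q P)
      then ereal (KL_divergence 2 Q P) else \<infinity>)"

definition relative_entropy_net ::
    "real \<Rightarrow> 'a::topological_space measure set \<Rightarrow> 'a measure set \<Rightarrow> bool" where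
  "relative_entropy_net \<epsilon> \<P> \<Q> \<longleftrightarrow>
     \<Q> \<subseteq> space (prob_algebra borel) \<and>
     (\<forall>P\<in>\<P>. \<exists>Q\<in>\<Q>. relative_entropy P Q \<le> ereal (\<epsilon>\<^sup>2))"

text \<open>The infimum is \<open>\<infinity>\<close> if there is no finite net, and is attained otherwise.\<close>
definition covering_number :: "real \<Rightarrow> 'a::topological_space measure set \<Rightarrow> enat" where
  "covering_number \<epsilon> \<P> =
     Inf {enat (card \<Q>) | \<Q>. finite \<Q> \<and> relative_entropy_net \<epsilon> \<P> \<Q>}"

text \<open>The supremum is \<open>\<infinity>\<close> if there are arbitrarily large packings, and is attained otherwise.\<close>
definition packing_number :: "real \<Rightarrow> 'p set \<Rightarrow> ('p \<Rightarrow> 'p \<Rightarrow> real) \<Rightarrow> enat" where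
  "packing_number r \<Theta> \<rho> =
     Sup {enat m | m. \<exists>\<theta> :: nat \<Rightarrow> 'p. (\<forall>i\<in>{1..m}. \<theta> i \<in> \<Theta>) \<and>
                        (\<forall>i\<in>{1..m}. \<forall>j\<in>{1..m}. i \<noteq> j \<longrightarrow> r < \<rho> (\<theta> i) (\<theta> j))}"

definition log2_enat :: "enat \<Rightarrow> ereal" where
  "log2_enat x =
     (case x of enat m \<Rightarrow> if m = 0 then -\<infinity> else ereal (log 2 (real m)) | \<infinity> \<Rightarrow> \<infinity>)"

abbreviation sample_space :: "nat \<Rightarrow> (nat \<Rightarrow> 'a::topological_space) measure" where
  "sample_space n \<equiv> PiM {..<n} (\<lambda>_. borel)"

text \<open>
  Estimators take values in \<open>\<Theta>\<close>. No \<open>\<sigma>\<close>-algebra on \<open>\<Theta>\<close> is fixed; the only measurability asked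
  for is that the loss is a random variable, so that the risk is a genuine expectation. Whenever
  a \<open>\<sigma>\<close>-algebra on \<open>\<Theta>\<close> makes every section \<open>L \<theta>\<close> measurable, all measurable estimators are included.
\<close>
definition estimators ::
    "nat \<Rightarrow> 'p set \<Rightarrow> ('p \<Rightarrow> 'p \<Rightarrow> real) \<Rightarrow> ((nat \<Rightarrow> 'a::topological_space) \<Rightarrow> 'p) set" where
  "estimators n \<Theta> L =
     {est \<in> space (sample_space n) \<rightarrow> \<Theta>.
        \<forall>\<theta>\<in>\<Theta>. (\<lambda>x. L \<theta> (est x)) \<in> borel_measurable (sample_space n)}"

definition risk ::
    "nat \<Rightarrow> ('p \<Rightarrow> 'a measure) \<Rightarrow> ('p \<Rightarrow> 'p \<Rightarrow> real) \<Rightarrow> 'p \<Rightarrow> ((nat \<Rightarrow> 'a) \<Rightarrow> 'p) \<Rightarrow> ennreal" where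
  "risk n p L \<theta> est = (\<integral>\<^sup>+ x. ennreal (L \<theta> (est x)) \<partial>(PiM {..<n} (\<lambda>_. p \<theta>)))"

definition minimax_risk ::
    "nat \<Rightarrow> 'p set \<Rightarrow> ('p \<Rightarrow> 'a::topological_space measure) \<Rightarrow> ('p \<Rightarrow> 'p \<Rightarrow> real) \<Rightarrow> ennreal" where
  "minimax_risk n \<Theta> p L = (INF est\<in>estimators n \<Theta> L. SUP \<theta>\<in>\<Theta>. risk n p L \<theta> est)"

end

theory Submission
  imports Defs
begin

text \<open>
  Given a packing \<open>\<theta>\<^sub>1, \<dots>, \<theta>\<^sub>m\<close> and an estimator, the events that the loss at \<open>\<theta>\<^sub>i\<close> is below \<open>\<Phi> \<delta>\<close>
  are disjoint by the triangle inequality, so a Fano bound on their average probability suffices.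
  Instead of mutual information, each product law is compared directly with the product of a nearby
  net element through the variational inequality for relative entropy,
  \<open>D(P \<parallel> Q) \<ge> s P(A) - 1 + (1 - 2\<^sup>s Q(A)) / (2 ln 2)\<close>. Summed over the packing with
  \<open>s = log (m / K)\<close>, the last term is nonnegative because disjointness bounds
  the total net mass of the events by \<open>K\<close>, and this leaves
  \<open>log m\<close> times the average probability at most \<open>log K + n \<epsilon>\<^sup>2 + 1\<close>.
\<close>

section \<open>Change of measure for product laws\<close>

text \<open>The likelihood ratio of a sample is the product of the one-coordinate ratios. On a
  rectangle the integrand factors over the coordinates, so Tonelli makes both measures agree there,
  and rectangles determine a finite product measure.\<close>

lemma PiM_density:
  assumes "finite I" and M: "\<And>i. prob_space (M i)"
    and f [measurable]: "\<And>i. f i \<in> borel_measurable (M i)"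
    and D: "\<And>i. prob_space (density (M i) (f i))"
  shows "PiM I (\<lambda>i. density (M i) (f i)) = density (PiM I M) (\<lambda>x. \<Prod>i\<in>I. f i (x i))"
proof -
  interpret M: product_prob_space M
    by (simp add: product_prob_space_def product_prob_space_axioms_def product_sigma_finite_def M
        prob_space_imp_sigma_finite)
  interpret D: product_prob_space "\<lambda>i. density (M i) (f i)"
    by (simp add: product_prob_space_def product_prob_space_axioms_def product_sigma_finite_def D
        prob_space_imp_sigma_finite)
  show ?thesis
  proof (rule D.PiM_eqI[symmetric])
    fix A assume "\<And>i. i \<in> I \<Longrightarrow> A i \<in> sets (density (M i) (f i))"
    then have A [measurable]: "A i \<in> sets (M i)" if "i \<in> I" for i
      using that by simp
    have B: "PiE I A \<in> sets (PiM I M)"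
      by (rule sets_PiM_I_finite[OF \<open>finite I\<close> A])
    have "emeasure (density (PiM I M) (\<lambda>x. \<Prod>i\<in>I. f i (x i))) (PiE I A)
        = (\<integral>\<^sup>+x. (\<Prod>i\<in>I. f i (x i)) * indicator (PiE I A) x \<partial>PiM I M)"
      by (rule emeasure_density[OF _ B]) measurable
    also have "\<dots> = (\<integral>\<^sup>+x. (\<Prod>i\<in>I. f i (x i) * indicator (A i) (x i)) \<partial>PiM I M)"
    proof (intro nn_integral_cong)
      fix x assume "x \<in> space (PiM I M)"
      then have "indicator (PiE I A) x = (\<Prod>i\<in>I. indicator (A i) (x i) :: ennreal)"
        using \<open>finite I\<close> by (auto simp: indicator_def space_PiM PiE_iff)
      then show "(\<Prod>i\<in>I. f i (x i)) * indicator (PiE I A) x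
          = (\<Prod>i\<in>I. f i (x i) * indicator (A i) (x i))"
        by (simp add: prod.distrib)
    qed
    also have "\<dots> = (\<Prod>i\<in>I. \<integral>\<^sup>+x. f i x * indicator (A i) x \<partial>M i)"
      using \<open>finite I\<close> by (intro M.product_nn_integral_prod) auto
    also have "\<dots> = (\<Prod>i\<in>I. emeasure (density (M i) (f i)) (A i))"
      by (intro prod.cong refl) (simp add: emeasure_density)
    finally show "emeasure (density (PiM I M) (\<lambda>x. \<Prod>i\<in>I. f i (x i))) (PiE I A)
        = (\<Prod>i\<in>I. emeasure (density (M i) (f i)) (A i))" .
  qed (use \<open>finite I\<close> in \<open>simp_all cong: sets_PiM_cong\<close>)
qed

text \<open>
  The test function \<open>G\<close> averages the exponential tilt \<open>2\<^sup>s\<close> on \<open>A\<close> with the constant \<open>1\<close>; the bound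
  is \<open>ln z \<le> z - 1\<close> at \<open>z = G / F\<close>, integrated against \<open>N\<close>.
\<close>
lemma log_density_event_bound:
  fixes F :: "'a \<Rightarrow> real" and s :: real
  assumes "prob_space M" "prob_space N"
    and N: "N = density M (\<lambda>x. ennreal (F x))"
    and F [measurable]: "F \<in> borel_measurable M" and F0: "\<And>x. 0 \<le> F x"
    and int: "integrable N (\<lambda>x. log 2 (F x))"
    and A [measurable]: "A \<in> sets M"
  shows "s * measure N A - 1 + (1 - 2 powr s * measure M A) / (2 * ln 2) \<le> (\<integral>x. log 2 (F x) \<partial>N)"
proof -
  interpret M: prob_space M by fact
  interpret N: prob_space N by fact
  have sN [measurable_cong]: "sets N = sets M" by (simp add: N)
  define G :: "'a \<Rightarrow> real" where "G x = (1 + 2 powr s * indicator A x) / 2" for x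
  have [measurable]: "G \<in> borel_measurable M" unfolding G_def by measurable
  have G0: "0 < G x" for x
    by (auto simp: G_def indicator_def add_pos_pos)
  have intG: "integrable M G"
    unfolding G_def by (auto simp: M.emeasure_eq_measure)
  have EG: "(\<integral>x. G x \<partial>M) = (1 + 2 powr s * measure M A) / 2"
    unfolding G_def by (subst integral_divide_zero, subst Bochner_Integration.integral_add)
       (auto simp: M.emeasure_eq_measure M.prob_space)
  have "(\<integral>\<^sup>+x. ennreal (G x / F x) \<partial>N) = (\<integral>\<^sup>+x. ennreal (F x) * ennreal (G x / F x) \<partial>M)"
    unfolding N by (rule nn_integral_density) auto
  \<comment> \<open>This is only an inequality: where \<open>F x = 0\<close>, the quotient
    \<open>G x / F x\<close> is \<open>0\<close>, so the integrand is \<open>0\<close> instead of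
    \<open>G x\<close>.\<close>
  also have "\<dots> \<le> (\<integral>\<^sup>+x. ennreal (G x) \<partial>M)"
  proof (intro nn_integral_mono)
    fix x
    have "ennreal (F x) * ennreal (G x / F x) = ennreal (F x * (G x / F x))"
      by (rule ennreal_mult'[symmetric]) (rule F0)
    also have "\<dots> \<le> ennreal (G x)"
      using G0[of x] by (intro ennreal_leI) auto
    finally show "ennreal (F x) * ennreal (G x / F x) \<le> ennreal (G x)" .
  qed
  also have "\<dots> = ennreal ((1 + 2 powr s * measure M A) / 2)"
    by (subst nn_integral_eq_integral[OF intG], rule AE_I2, rule less_imp_le[OF G0], subst EG) simp
  finally have le: "(\<integral>\<^sup>+x. ennreal (G x / F x) \<partial>N) \<le> ennreal ((1 + 2 powr s * measure M A) / 2)" .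
  have GF0: "0 \<le> G x / F x" for x
    using F0[of x] G0[of x] by simp
  have intGF: "integrable N (\<lambda>x. G x / F x)"
    using le GF0 by (intro integrableI_nonneg) (auto simp: le_less_trans)
  have EGF: "(\<integral>x. G x / F x \<partial>N) \<le> (1 + 2 powr s * measure M A) / 2"
    using le GF0 intGF by (subst (asm) nn_integral_eq_integral) auto
  have pos: "AE x in N. 0 < F x"
    unfolding N by (subst AE_density) auto
  have pt: "s * indicator A x - 1 + (1 - G x / F x) / ln 2 \<le> log 2 (F x)" if "0 < F x" for x
  proof -
    \<comment> \<open>The averaging factor 1/2 in \<open>G\<close> costs one bit: \<open>G\<close>
      is at least \<open>2 powr s / 2\<close> on \<open>A\<close> and equals \<open>1 / 2\<close>
      off \<open>A\<close>.\<close>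
    have "s * indicator A x - 1 \<le> log 2 (G x)"
    proof (cases "x \<in> A")
      case True
      have "log 2 (2 powr s / 2) \<le> log 2 (G x)"
        using True by (subst log_le_cancel_iff) (auto simp: G_def add_pos_pos)
      then show ?thesis using True by (simp add: log_divide)
    qed (simp add: G_def log_divide)
    moreover have "ln (G x / F x) \<le> G x / F x - 1"
      using G0[of x] that by (intro ln_le_minus_one) auto
    then have "log 2 (G x) - log 2 (F x) \<le> (G x / F x - 1) / ln 2"
      using G0[of x] that by (simp add: log_def ln_div divide_right_mono flip: diff_divide_distrib)
    ultimately show ?thesis
      by (simp add: diff_divide_distrib)
  qed
  have intL: "integrable N (\<lambda>x. s * indicator A x - 1 + (1 - G x / F x) / ln 2)"
    using intGF by (auto simp: N.emeasure_eq_measure)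
  have "(\<integral>x. s * indicator A x - 1 + (1 - G x / F x) / ln 2 \<partial>N) \<le> (\<integral>x. log 2 (F x) \<partial>N)"
    using intL int by (rule integral_mono_AE) (use pos pt in auto)
  moreover have "(\<integral>x. s * indicator A x - 1 + (1 - G x / F x) / ln 2 \<partial>N)
      = s * measure N A - 1 + (1 - (\<integral>x. G x / F x \<partial>N)) / ln 2"
    using intGF by (simp add: N.emeasure_eq_measure N.prob_space)
  moreover have "(1 - (1 + 2 powr s * measure M A) / 2) / ln 2 \<le> (1 - (\<integral>x. G x / F x \<partial>N)) / ln 2"
    using EGF by (intro divide_right_mono) auto
  moreover have "(1 - (1 + 2 powr s * measure M A) / 2) / ln 2
      = (1 - 2 powr s * measure M A) / (2 * ln 2)"
    by (simp add: field_simps)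
  ultimately show ?thesis by linarith
qed

text \<open>Relative entropy tensorizes: under the product of \<open>P\<close> the log-likelihood
  ratio is almost surely a sum of \<open>n\<close> terms, each with mean the relative entropy of one
  observation. The event bound is then applied to the two product laws.\<close>

lemma relative_entropy_product_event_bound:
  fixes c s :: real
  assumes P: "prob_space P" and Q: "prob_space Q" and sets: "sets P = sets Q"
    and D: "relative_entropy P Q \<le> ereal c"
    and A: "A \<in> sets (PiM {..<n::nat} (\<lambda>_. Q))"
  shows "s * measure (PiM {..<n} (\<lambda>_. P)) A - 1
      + (1 - 2 powr s * measure (PiM {..<n} (\<lambda>_. Q)) A) / (2 * ln 2) \<le> real n * c"
proof -
  interpret P: prob_space P by fact
  interpret Q: prob_space Q by fact
  note sets[measurable_cong]
  from D have ac: "absolutely_continuous Q P" and int: "integrable P (entropy_density 2 Q P)"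
    and KL: "KL_divergence 2 Q P \<le> c"
    by (auto simp: relative_entropy_def split: if_splits)
  \<comment> \<open>\<open>entropy_density\<close> is the logarithm of exactly this real version of
    the Radon-Nikodym derivative. The derivative is finite \<open>Q\<close>-almost everywhere, so
    \<open>f\<close> is still a density of \<open>P\<close>.\<close>
  define f where "f x = enn2real (RN_deriv Q P x)" for x
  have [measurable]: "f \<in> borel_measurable Q" unfolding f_def by measurable
  have f0: "0 \<le> f x" for x by (simp add: f_def)
  have ed: "entropy_density 2 Q P = (\<lambda>x. log 2 (f x))"
    by (simp add: entropy_density_def f_def fun_eq_iff)
  have "AE x in Q. RN_deriv Q P x \<noteq> \<infinity>"
    using P.sigma_finite_measure_axioms ac sets by (rule Q.RN_deriv_finite)
  then have "AE x in Q. RN_deriv Q P x = ennreal (f x)"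
    by eventually_elim (auto simp: f_def less_top)
  then have "density Q (RN_deriv Q P) = density Q (\<lambda>x. ennreal (f x))"
    by (intro density_cong) auto
  then have Pf: "P = density Q (\<lambda>x. ennreal (f x))"
    using Q.density_RN_deriv[OF ac sets] by simp
  let ?P = "PiM {..<n} (\<lambda>_. P)" and ?Q = "PiM {..<n} (\<lambda>_. Q)"
  define F where "F x = (\<Prod>i<n. f (x i))" for x
  have [measurable]: "F \<in> borel_measurable ?Q" unfolding F_def by measurable
  have "?P = density ?Q (\<lambda>x. \<Prod>i<n. ennreal (f (x i)))"
    unfolding Pf by (rule PiM_density) (use P Q in \<open>auto simp flip: Pf\<close>)
  then have PF: "?P = density ?Q (\<lambda>x. ennreal (F x))"
    by (simp add: F_def prod_ennreal f0)
  \<comment> \<open>The logarithm of the product splits into a sum where all factors are positive. A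
    density vanishes only on a null set of its own measure, so this holds almost surely under
    \<open>?P\<close>.\<close>
  have AEP: "AE x in P. 0 < f x"
    by (subst Pf, subst AE_density) auto
  have "AE x in ?P. \<forall>i\<in>{..<n}. 0 < f (x i)"
    by (intro eventually_ball_finite ballI AE_PiM_component P AEP) auto
  then have eq: "AE x in ?P. (\<Sum>i<n. log 2 (f (x i))) = log 2 (F x)"
  proof eventually_elim
    case (elim x)
    then have "ln (F x) = (\<Sum>i<n. ln (f (x i)))"
      unfolding F_def by (intro ln_prod) (use elim in force)+
    then show ?case by (simp add: log_def sum_divide_distrib)
  qed
  have dist: "distr ?P P (\<lambda>x. x i) = P" if "i < n" for i
    using that by (intro distr_PiM_component P) auto
  have inti: "integrable ?P (\<lambda>x. log 2 (f (x i)))" if "i < n" for i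
    using int that unfolding ed by (subst (asm) dist[OF that, symmetric], subst (asm) integrable_distr_eq) auto
  have Ei: "(\<integral>x. log 2 (f (x i)) \<partial>?P) = KL_divergence 2 Q P" if "i < n" for i
    unfolding KL_divergence_def ed
    using that by (subst (2) dist[OF that, symmetric], subst integral_distr) auto
  have sP: "sets ?P = sets ?Q" using sets by (intro sets_PiM_cong) auto
  have m1: "(\<lambda>x. log 2 (F x)) \<in> borel_measurable ?P"
    by (subst measurable_cong_sets[OF sP refl]) measurable
  have intS: "integrable ?P (\<lambda>x. \<Sum>i<n. log 2 (f (x i)))"
    using inti by (intro Bochner_Integration.integrable_sum) auto
  have intF: "integrable ?P (\<lambda>x. log 2 (F x))"
    using intS m1 eq by (subst integrable_cong_AE[OF m1 _ AE_symmetric]) auto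
  have "(\<integral>x. log 2 (F x) \<partial>?P) = (\<integral>x. (\<Sum>i<n. log 2 (f (x i))) \<partial>?P)"
    using intS m1 eq by (intro integral_cong_AE) auto
  also have "\<dots> = real n * KL_divergence 2 Q P"
    using inti Ei by (subst Bochner_Integration.integral_sum) auto
  also have "\<dots> \<le> real n * c"
    using KL by (intro mult_left_mono) auto
  finally have "(\<integral>x. log 2 (F x) \<partial>?P) \<le> real n * c" .
  moreover have "s * measure ?P A - 1 + (1 - 2 powr s * measure ?Q A) / (2 * ln 2)
      \<le> (\<integral>x. log 2 (F x) \<partial>?P)"
    by (rule log_density_event_bound[OF _ _ PF])
      (use A intF in \<open>auto intro!: prob_space_PiM P Q prod_nonneg f0 simp: F_def\<close>)
  ultimately show ?thesis by linarith
qed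

section \<open>Fano bound for disjoint events\<close>

text \<open>With \<open>A i\<close> read as the event that a decoder outputs \<open>i\<close>, the
  sum divided by \<open>card I\<close> is the success probability under a uniform prior. On the
  right, \<open>log 2 (card \<Q>)\<close> pays for the choice of a net element, \<open>c\<close> per
  observation for the distance to it, and the \<open>1\<close> is the bit lost in the event
  bound.\<close>

lemma disjoint_events_fano_bound:
  fixes P :: "'i \<Rightarrow> 'a measure" and A :: "'i \<Rightarrow> (nat \<Rightarrow> 'a) set" and N :: "'a measure" and c :: real
  assumes I: "finite I" "I \<noteq> {}" and \<Q>: "finite \<Q>"
    and P: "\<And>i. i \<in> I \<Longrightarrow> P i \<in> space (prob_algebra N)" and Q: "\<Q> \<subseteq> space (prob_algebra N)"
    and net: "\<And>i. i \<in> I \<Longrightarrow> \<exists>Q\<in>\<Q>. relative_entropy (P i) Q \<le> ereal c"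
    and A: "\<And>i. i \<in> I \<Longrightarrow> A i \<in> sets (PiM {..<n} (\<lambda>_. N))" and disj: "disjoint_family_on A I"
  shows "(\<Sum>i\<in>I. measure (PiM {..<n} (\<lambda>_. P i)) (A i)) / card I * log 2 (card I)
    \<le> log 2 (card \<Q>) + real n * c + 1"
proof -
  obtain q where q: "\<And>i. i \<in> I \<Longrightarrow> q i \<in> \<Q> \<and> relative_entropy (P i) (q i) \<le> ereal c"
    using net by metis
  define m K where "m = real (card I)" and "K = real (card \<Q>)"
  have m: "m > 0" using I by (auto simp: m_def card_gt_0_iff)
  have "\<Q> \<noteq> {}" using q I by auto
  then have K: "K \<ge> 1" using \<Q> by (auto simp: K_def Suc_le_eq card_gt_0_iff)
  define s where "s = log 2 (m / K)"
  have s: "2 powr s = m / K" using m K by (simp add: s_def)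
  define a where "a i = measure (PiM {..<n} (\<lambda>_. P i)) (A i)" for i
  define b where "b i = measure (PiM {..<n} (\<lambda>_. q i)) (A i)" for i
  have prob: "prob_space (P i)" "sets (P i) = sets N" if "i \<in> I" for i
    using P[OF that] by (auto simp: space_prob_algebra)
  have Qprob: "prob_space R" "sets R = sets N" if "R \<in> \<Q>" for R
    using Q that by (auto simp: space_prob_algebra)
  have Qn: "prob_space (PiM {..<n} (\<lambda>_. R))" "sets (PiM {..<n} (\<lambda>_. R)) = sets (PiM {..<n} (\<lambda>_. N))"
    if "R \<in> \<Q>" for R
    using Qprob[OF that] by (auto intro!: prob_space_PiM sets_PiM_cong)
  have "s * a i - 1 + (1 - 2 powr s * b i) / (2 * ln 2) \<le> real n * c" if "i \<in> I" for i
    unfolding a_def b_def using q[OF that] prob[OF that] Qprob[of "q i"] Qn(2)[of "q i"] A[OF that]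
    by (intro relative_entropy_product_event_bound) auto
  then have "(\<Sum>i\<in>I. s * a i - 1 + (1 - 2 powr s * b i) / (2 * ln 2)) \<le> (\<Sum>i\<in>I. real n * c)"
    by (intro sum_mono) auto
  then have main: "s * sum a I - m + (m - m / K * sum b I) / (2 * ln 2) \<le> m * (real n * c)"
    by (simp add: s sum.distrib sum_subtractf m_def flip: sum_distrib_left sum_divide_distrib)
  \<comment> \<open>The net element \<open>q i\<close> varies with \<open>i\<close>, so disjointness
    cannot be used directly. Summing over all of \<open>\<Q>\<close> and swapping the sums leaves
    one fixed probability measure at a time, contributing at most \<open>1\<close>.\<close>
  have "sum b I \<le> (\<Sum>i\<in>I. \<Sum>R\<in>\<Q>. measure (PiM {..<n} (\<lambda>_. R)) (A i))"
    unfolding b_def using q \<Q> by (intro sum_mono member_le_sum) auto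
  also have "\<dots> = (\<Sum>R\<in>\<Q>. \<Sum>i\<in>I. measure (PiM {..<n} (\<lambda>_. R)) (A i))"
    by (rule sum.swap)
  also have "\<dots> \<le> (\<Sum>R\<in>\<Q>. 1)"
  proof (rule sum_mono)
    fix R assume R: "R \<in> \<Q>"
    interpret R: prob_space "PiM {..<n} (\<lambda>_. R)" using Qn[OF R] by simp
    have "(\<Sum>i\<in>I. R.prob (A i)) = R.prob (\<Union>i\<in>I. A i)"
      using I A disj Qn(2)[OF R] by (intro R.finite_measure_finite_Union[symmetric]) auto
    then show "(\<Sum>i\<in>I. R.prob (A i)) \<le> 1" by simp
  qed
  finally have "m / K * sum b I \<le> m / K * K"
    using m K by (intro mult_left_mono) (auto simp: K_def)
  then have "0 \<le> (m - m / K * sum b I) / (2 * ln 2)"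
    using K by (intro divide_nonneg_nonneg) auto
  with main have "s * sum a I \<le> m * (real n * c + 1)"
    by (simp add: algebra_simps)
  then have 1: "sum a I / m * s \<le> real n * c + 1"
    using m by (simp add: field_simps)
  \<comment> \<open>Replacing \<open>log 2 (m / K)\<close> by \<open>log 2 m\<close> adds the
    average probability times \<open>log 2 K\<close>. This is at most \<open>log 2 K\<close>,
    because the average is at most \<open>1\<close> and \<open>K \<ge> 1\<close>.\<close>
  have "sum a I \<le> (\<Sum>i\<in>I. 1)"
    unfolding a_def by (intro sum_mono prob_space.prob_le_1 prob_space_PiM prob)
  then have "sum a I / m \<le> 1" using m by (simp add: m_def)
  then have 2: "sum a I / m * log 2 K \<le> log 2 K"
    using K by (intro mult_left_le_one_le) (auto simp: a_def m_def intro!: divide_nonneg_nonneg sum_nonneg)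
  have "log 2 m = s + log 2 K" using m K by (simp add: s_def log_divide)
  then have "sum a I / m * log 2 m = sum a I / m * s + sum a I / m * log 2 K"
    by (simp only: distrib_left)
  with 1 2 have "sum a I / m * log 2 m \<le> log 2 K + real n * c + 1"
    by linarith
  then show ?thesis
    by (simp add: m_def K_def a_def)
qed

section \<open>From estimation to testing\<close>

text \<open>By Markov's inequality at the threshold \<open>\<Phi> \<delta>\<close>, a uniform risk
  bound \<open>r\<close> forces small loss to be likely at every packing point. Averaged over the
  packing, this meets the Fano upper bound on the same probabilities.\<close>

lemma finite_packing_risk_bound:
  fixes p :: "'p \<Rightarrow> 'a::topological_space measure" and \<theta> :: "nat \<Rightarrow> 'p"
  assumes p: "\<And>\<theta>. \<theta> \<in> \<Theta> \<Longrightarrow> p \<theta> \<in> space (prob_algebra borel)"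
    and \<rho>: "pseudometric_on \<Theta> \<rho>"
    and \<Phi>: "\<Phi> \<in> {0..} \<rightarrow> {0..}" "mono_on {0..} \<Phi>" and \<delta>: "\<delta> > 0"
    and net: "finite \<Q>" "relative_entropy_net \<epsilon> (p ` \<Theta>) \<Q>"
    and m: "m \<ge> 2" and \<theta>: "\<forall>i\<in>{1..m}. \<theta> i \<in> \<Theta>"
    and sep: "\<forall>i\<in>{1..m}. \<forall>j\<in>{1..m}. i \<noteq> j \<longrightarrow> 2 * \<delta> < \<rho> (\<theta> i) (\<theta> j)"
    and est: "est \<in> estimators n \<Theta> (\<lambda>\<theta> \<theta>'. \<Phi> (\<rho> \<theta> \<theta>'))"
    and r: "r \<ge> 0" "\<And>\<theta>. \<theta> \<in> \<Theta> \<Longrightarrow> risk n p (\<lambda>\<theta> \<theta>'. \<Phi> (\<rho> \<theta> \<theta>')) \<theta> est \<le> ennreal r"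
  shows "\<Phi> \<delta> * (1 - (log 2 (card \<Q>) + real n * \<epsilon>\<^sup>2 + 1) / log 2 m) \<le> r"
proof -
  let ?S = "sample_space n :: (nat \<Rightarrow> 'a) measure"
  \<comment> \<open>The event is phrased through the loss because measurability of an estimator is
    only required there. Strictness lets monotonicity give a distance below \<open>\<delta>\<close>
    even where \<open>\<Phi>\<close> is flat.\<close>
  define A where "A i = {x \<in> space ?S. \<Phi> (\<rho> (\<theta> i) (est x)) < \<Phi> \<delta>}" for i
  have est\<Theta>: "est x \<in> \<Theta>" if "x \<in> space ?S" for x
    using est that by (auto simp: estimators_def)
  have meas: "(\<lambda>x. \<Phi> (\<rho> (\<theta> i) (est x))) \<in> borel_measurable ?S" if "i \<in> {1..m}" for i
    using est \<theta> that by (auto simp: estimators_def)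
  have A: "A i \<in> sets ?S" if "i \<in> {1..m}" for i
    unfolding A_def using meas[OF that] by measurable
  have close: "\<rho> (\<theta> i) (est x) < \<delta>" if "x \<in> A i" "i \<in> {1..m}" for x i
  proof (rule ccontr)
    assume "\<not> \<rho> (\<theta> i) (est x) < \<delta>"
    then have "\<Phi> \<delta> \<le> \<Phi> (\<rho> (\<theta> i) (est x))"
      using \<delta> by (intro mono_onD[OF \<Phi>(2)]) auto
    then show False using that by (auto simp: A_def)
  qed
  have disj: "disjoint_family_on A {1..m}"
  proof (unfold disjoint_family_on_def, intro ballI impI, rule ccontr)
    fix i j assume ij: "i \<in> {1..m}" "j \<in> {1..m}" "i \<noteq> j" and "A i \<inter> A j \<noteq> {}"
    then obtain x where x: "x \<in> A i" "x \<in> A j" by auto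
    then have "est x \<in> \<Theta>" using est\<Theta> by (auto simp: A_def)
    then have "\<rho> (\<theta> i) (\<theta> j) \<le> \<rho> (\<theta> i) (est x) + \<rho> (\<theta> j) (est x)"
      using \<rho> bspec[OF \<theta> ij(1)] bspec[OF \<theta> ij(2)] unfolding pseudometric_on_def by metis
    moreover have "2 * \<delta> < \<rho> (\<theta> i) (\<theta> j)"
      using sep ij by blast
    ultimately show False using close[OF x(1) ij(1)] close[OF x(2) ij(2)] by linarith
  qed
  have "(\<Sum>i\<in>{1..m}. measure (PiM {..<n} (\<lambda>_. p (\<theta> i))) (A i)) / card {1..m} * log 2 (card {1..m})
      \<le> log 2 (card \<Q>) + real n * \<epsilon>\<^sup>2 + 1"
    using net \<theta> p m
    by (intro disjoint_events_fano_bound[where N = borel] A disj) (auto simp: relative_entropy_net_def)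
  moreover define a where "a i = measure (PiM {..<n} (\<lambda>_. p (\<theta> i))) (A i)" for i
  ultimately have "sum a {1..m} / m * log 2 m \<le> log 2 (card \<Q>) + real n * \<epsilon>\<^sup>2 + 1"
    by simp
  then have avg: "sum a {1..m} / m \<le> (log 2 (card \<Q>) + real n * \<epsilon>\<^sup>2 + 1) / log 2 m"
    using m by (simp add: field_simps)
  have \<Phi>\<delta>: "\<Phi> \<delta> \<ge> 0" using \<Phi> \<delta> by auto
  have each: "\<Phi> \<delta> * (1 - a i) \<le> r" if i: "i \<in> {1..m}" for i
  proof -
    let ?P = "PiM {..<n} (\<lambda>_. p (\<theta> i))"
    have pi: "prob_space (p (\<theta> i))" "sets (p (\<theta> i)) = sets borel"
      using p[of "\<theta> i"] \<theta> i by (auto simp: space_prob_algebra)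
    interpret prob_space ?P by (intro prob_space_PiM pi)
    have sP: "sets ?P = sets ?S" using pi by (intro sets_PiM_cong) auto
    then have spP: "space ?P = space ?S" by (rule sets_eq_imp_space_eq)
    have AP: "A i \<in> events" using A[OF i] sP by simp
    have "ennreal (\<Phi> \<delta> * (1 - a i)) = ennreal (\<Phi> \<delta>) * emeasure ?P (space ?P - A i)"
      using AP \<Phi>\<delta> by (simp add: a_def emeasure_eq_measure prob_compl ennreal_mult')
    also have "\<dots> = (\<integral>\<^sup>+x. ennreal (\<Phi> \<delta>) * indicator (space ?P - A i) x \<partial>?P)"
      using AP by (subst nn_integral_cmult_indicator) auto
    also have "\<dots> \<le> risk n p (\<lambda>\<theta> \<theta>'. \<Phi> (\<rho> \<theta> \<theta>')) (\<theta> i) est"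
      unfolding risk_def
      by (intro nn_integral_mono) (auto simp: indicator_def A_def spP not_less intro: ennreal_leI)
    also have "\<dots> \<le> ennreal r" using r \<theta> i by auto
    finally show ?thesis using r by simp
  qed
  have "(\<Sum>i\<in>{1..m}. \<Phi> \<delta> * (1 - a i)) \<le> (\<Sum>i\<in>{1..m}. r)"
    using each by (intro sum_mono)
  then have "\<Phi> \<delta> * (m - sum a {1..m}) \<le> m * r"
    by (simp add: sum_subtractf flip: sum_distrib_left)
  then have "\<Phi> \<delta> * (1 - sum a {1..m} / m) \<le> r"
    using m by (simp add: field_simps)
  moreover have "\<Phi> \<delta> * (1 - (log 2 (card \<Q>) + real n * \<epsilon>\<^sup>2 + 1) / log 2 m)
      \<le> \<Phi> \<delta> * (1 - sum a {1..m} / m)"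
    using avg \<Phi>\<delta> by (intro mult_left_mono) auto
  ultimately show ?thesis by linarith
qed

section \<open>Covering and packing numbers\<close>

text \<open>A finite value rules out an empty family of nets, whose infimum is
  \<open>\<infinity>\<close>; a nonempty set of extended naturals contains its infimum by
  well-ordering.\<close>

lemma covering_number_attained:
  assumes "covering_number \<epsilon> \<P> = enat K"
  obtains \<Q> where "finite \<Q>" "relative_entropy_net \<epsilon> \<P> \<Q>" "card \<Q> = K"
proof -
  let ?X = "{enat (card \<Q>) | \<Q>. finite \<Q> \<and> relative_entropy_net \<epsilon> \<P> \<Q>}"
  have "?X \<noteq> {}"
  proof
    assume "?X = {}"
    then have "covering_number \<epsilon> \<P> = \<infinity>"
      unfolding covering_number_def by (simp only: Inf_empty top_enat_def)
    then show False using assms by simp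
  qed
  then have "Inf ?X \<in> ?X"
    unfolding Inf_enat_def by (simp only: if_False) (rule LeastI_ex, blast)
  then show thesis using assms that by (auto simp: covering_number_def)
qed

text \<open>Packings can be truncated, so their sizes form an initial segment, and a supremum that
  is at least a finite \<open>m\<close> is witnessed by some size at least \<open>m\<close>.
  Quantifying over finite \<open>m\<close> also covers an infinite packing number.\<close>

lemma le_packing_number_iff:
  "enat m \<le> packing_number r \<Theta> \<rho> \<longleftrightarrow>
     (\<exists>\<theta>. (\<forall>i\<in>{1..m}. \<theta> i \<in> \<Theta>) \<and> (\<forall>i\<in>{1..m}. \<forall>j\<in>{1..m}. i \<noteq> j \<longrightarrow> r < \<rho> (\<theta> i) (\<theta> j)))"
  (is "_ \<longleftrightarrow> ?packing m")
proof
  assume "?packing m"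
  then show "enat m \<le> packing_number r \<Theta> \<rho>"
    unfolding packing_number_def by (intro Sup_upper) blast
next
  assume le: "enat m \<le> packing_number r \<Theta> \<rho>"
  have "\<exists>k\<ge>m. ?packing k"
  proof (rule ccontr)
    assume "\<not> (\<exists>k\<ge>m. ?packing k)"
    then have lt: "k < m" if "?packing k" for k using that not_less by blast
    \<comment> \<open>The empty packing has size \<open>0\<close>, so \<open>m - 1\<close> is a true
      predecessor.\<close>
    then have "m > 0" using lt[of 0] by auto
    have "packing_number r \<Theta> \<rho> \<le> enat (m - 1)"
      unfolding packing_number_def using lt by (intro Sup_least) fastforce
    with le have "enat m \<le> enat (m - 1)" by (rule order_trans)
    with \<open>m > 0\<close> show False by simp
  qed
  then obtain k \<theta> where "m \<le> k" "\<forall>i\<in>{1..k}. \<theta> i \<in> \<Theta>"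
      "\<forall>i\<in>{1..k}. \<forall>j\<in>{1..k}. i \<noteq> j \<longrightarrow> r < \<rho> (\<theta> i) (\<theta> j)"
    by blast
  then show "?packing m" by (intro exI[of _ \<theta>]) auto
qed

section \<open>Minimax risk and extended-real boundary cases\<close>

text \<open>Any admissible size \<open>m\<close> is allowed in place of the packing number itself,
  so that an infinite packing number can be reached by letting \<open>m\<close> grow.\<close>

lemma finite_packing_minimax_bound:
  fixes p :: "'p \<Rightarrow> 'a::topological_space measure"
  assumes p: "\<And>\<theta>. \<theta> \<in> \<Theta> \<Longrightarrow> p \<theta> \<in> space (prob_algebra borel)"
    and \<rho>: "pseudometric_on \<Theta> \<rho>"
    and \<Phi>: "\<Phi> \<in> {0..} \<rightarrow> {0..}" "mono_on {0..} \<Phi>" and \<delta>: "\<delta> > 0"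
    and K: "covering_number \<epsilon> (p ` \<Theta>) = enat K"
    and m: "m \<ge> 2" "enat m \<le> packing_number (2 * \<delta>) \<Theta> \<rho>"
  shows "ereal (\<Phi> \<delta> * (1 - (log 2 K + real n * \<epsilon>\<^sup>2 + 1) / log 2 m))
    \<le> enn2ereal (minimax_risk n \<Theta> p (\<lambda>\<theta> \<theta>'. \<Phi> (\<rho> \<theta> \<theta>')))" (is "ereal ?B \<le> enn2ereal ?R")
proof -
  obtain \<Q> where \<Q>: "finite \<Q>" "relative_entropy_net \<epsilon> (p ` \<Theta>) \<Q>" "card \<Q> = K"
    using covering_number_attained[OF K] by blast
  obtain \<theta> where \<theta>: "\<forall>i\<in>{1..m}. \<theta> i \<in> \<Theta>"
      "\<forall>i\<in>{1..m}. \<forall>j\<in>{1..m}. i \<noteq> j \<longrightarrow> 2 * \<delta> < \<rho> (\<theta> i) (\<theta> j)"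
    using m(2) unfolding le_packing_number_iff by blast
  have "ennreal ?B \<le> (SUP \<theta>\<in>\<Theta>. risk n p (\<lambda>\<theta> \<theta>'. \<Phi> (\<rho> \<theta> \<theta>')) \<theta> est)" (is "_ \<le> ?S")
    if "est \<in> estimators n \<Theta> (\<lambda>\<theta> \<theta>'. \<Phi> (\<rho> \<theta> \<theta>'))" for est
  proof (cases ?S)
    case (real r)
    have "risk n p (\<lambda>\<theta> \<theta>'. \<Phi> (\<rho> \<theta> \<theta>')) t est \<le> ennreal r" if "t \<in> \<Theta>" for t
      unfolding real(2)[symmetric] using that by (rule SUP_upper)
    then have "?B \<le> r"
      using finite_packing_risk_bound[OF p \<rho> \<Phi> \<delta> \<Q>(1,2) m(1) \<theta> that real(1)] \<Q>(3) by simp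
    then show ?thesis using real by (simp add: ennreal_leI)
  next
    case top
    show ?thesis unfolding top by (rule top_greatest)
  qed
  then have "ennreal ?B \<le> ?R"
    unfolding minimax_risk_def by (intro INF_greatest)
  then have "enn2ereal (ennreal ?B) \<le> enn2ereal ?R"
    by (simp add: less_eq_ennreal.rep_eq)
  \<comment> \<open>\<open>ennreal\<close> sends a negative bound to \<open>0\<close>, which only
    raises it.\<close>
  moreover have "ereal ?B \<le> enn2ereal (ennreal ?B)"
    by (cases "?B \<ge> 0") (simp_all add: ennreal_neg zero_ennreal.rep_eq)
  ultimately show ?thesis by (rule order_trans[rotated])
qed

theorem theorem0p14:
  fixes p :: "'p \<Rightarrow> (real ^ 'k) measure" and \<Theta> :: "'p set"
    and \<rho> :: "'p \<Rightarrow> 'p \<Rightarrow> real" and \<Phi> :: "real \<Rightarrow> real"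
    and \<epsilon> \<delta> :: real and n :: nat
  assumes "\<And>\<theta>. \<theta> \<in> \<Theta> \<Longrightarrow> p \<theta> \<in> space (prob_algebra borel)"
    and "pseudometric_on \<Theta> \<rho>"
    and "\<Phi> \<in> {0..} \<rightarrow> {0..}" and "mono_on {0..} \<Phi>" and "\<Phi> 0 = 0"
    and "\<epsilon> > 0" and "\<delta> > 0"
    and "covering_number \<epsilon> (p ` \<Theta>) \<noteq> \<infinity> \<or> packing_number (2 * \<delta>) \<Theta> \<rho> \<noteq> \<infinity>"
  shows "enn2ereal (minimax_risk n \<Theta> p (\<lambda>\<theta> \<theta>'. \<Phi> (\<rho> \<theta> \<theta>')))
      \<ge> ereal (\<Phi> \<delta>) *
          (1 - (log2_enat (covering_number \<epsilon> (p ` \<Theta>)) + ereal (real n * \<epsilon>\<^sup>2) + 1)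
                 / log2_enat (packing_number (2 * \<delta>) \<Theta> \<rho>))"
    (is "enn2ereal ?R \<ge> ereal (\<Phi> \<delta>) * (1 - (?K + _ + 1) / ?M)")
proof (cases "\<Theta> = {}")
  case True
  \<comment> \<open>An estimator would have to map this nonempty space into the empty
    \<open>\<Theta>\<close>. Hence there is none, and the infimum over the empty set is
    \<open>\<infinity>\<close>.\<close>
  have "space (sample_space n :: (nat \<Rightarrow> real ^ 'k) measure) \<noteq> {}"
    by (simp add: space_PiM PiE_eq_empty_iff)
  then have "estimators n \<Theta> (\<lambda>\<theta> \<theta>'. \<Phi> (\<rho> \<theta> \<theta>')) = ({} :: ((nat \<Rightarrow> real ^ 'k) \<Rightarrow> 'p) set)"
    using True by (auto simp: estimators_def Pi_iff)
  then have "?R = \<infinity>" by (simp add: minimax_risk_def)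
  then show ?thesis by simp
next
  case False
  have \<Phi>\<delta>: "\<Phi> \<delta> \<ge> 0" using assms(3,7) by auto
  have bound: "ereal (\<Phi> \<delta> * (1 - (log 2 K + real n * \<epsilon>\<^sup>2 + 1) / log 2 m)) \<le> enn2ereal ?R"
    if "covering_number \<epsilon> (p ` \<Theta>) = enat K" "m \<ge> 2" "enat m \<le> packing_number (2 * \<delta>) \<Theta> \<rho>"
    for K m :: nat
    using assms(1-4,7) that by (rule finite_packing_minimax_bound)
  \<comment> \<open>For nonempty \<open>\<Theta>\<close> both numbers are at least \<open>1\<close>,
    so \<open>log2_enat\<close> never takes its value \<open>-\<infinity>\<close> at
    \<open>0\<close>.\<close>
  have K0: "covering_number \<epsilon> (p ` \<Theta>) \<noteq> 0"
  proof
    assume "covering_number \<epsilon> (p ` \<Theta>) = 0"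
    then obtain \<Q> where "finite \<Q>" "relative_entropy_net \<epsilon> (p ` \<Theta>) \<Q>" "card \<Q> = 0"
      using covering_number_attained[of \<epsilon> "p ` \<Theta>" 0] by (metis zero_enat_def)
    then show False using False by (auto simp: relative_entropy_net_def)
  qed
  have M1: "enat 1 \<le> packing_number (2 * \<delta>) \<Theta> \<rho>"
    using False unfolding le_packing_number_iff by auto
  \<comment> \<open>The right side is then \<open>-\<infinity>\<close>, or \<open>0\<close> when
    \<open>\<Phi> \<delta> = 0\<close> since \<open>0\<close> times \<open>-\<infinity>\<close> is
    \<open>0\<close> in \<open>ereal\<close>; the risk is nonnegative.\<close>
  have trivial: ?thesis if "(?K + ereal (real n * \<epsilon>\<^sup>2) + 1) / ?M = \<infinity>"
  proof -
    have "(1 :: ereal) - \<infinity> = -\<infinity>" by (simp add: one_ereal_def)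
    then have "ereal (\<Phi> \<delta>) * (1 - \<infinity>) \<le> 0"
      using \<Phi>\<delta> by (cases "\<Phi> \<delta> = 0") (auto simp flip: zero_ereal_def)
    then show ?thesis unfolding that using enn2ereal_nonneg order_trans by blast
  qed
  show ?thesis
  proof (cases "covering_number \<epsilon> (p ` \<Theta>)")
    case infinity
    \<comment> \<open>The assumption that one of the two numbers is finite excludes
      \<open>\<infinity> / \<infinity>\<close>. For \<open>M = 1\<close> the denominator is
      \<open>0\<close>, and \<open>\<infinity> / 0\<close> is \<open>\<infinity>\<close> in
      \<open>ereal\<close>.\<close>
    with assms(8) obtain M where M: "packing_number (2 * \<delta>) \<Theta> \<rho> = enat M" by auto
    with M1 have "M \<ge> 1" by simp
    then have "\<infinity> / ereal (log 2 M) = \<infinity>"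
      by (cases "M = 1") auto
    with \<open>M \<ge> 1\<close> show ?thesis by (intro trivial) (simp add: infinity M log2_enat_def)
  next
    case (enat K)
    with K0 have K: "K > 0" by (auto simp: zero_enat_def)
    define c where "c = log 2 K + real n * \<epsilon>\<^sup>2 + 1"
    have c: "c > 0" using K by (auto simp: c_def intro!: add_nonneg_pos add_nonneg_nonneg)
    have num: "?K + ereal (real n * \<epsilon>\<^sup>2) + 1 = ereal c"
      using K by (simp add: enat log2_enat_def c_def one_ereal_def)
    show ?thesis
    proof (cases "packing_number (2 * \<delta>) \<Theta> \<rho>")
      case M: (enat M)
      show ?thesis
      proof (cases "M \<ge> 2")
        case True
        define l where "l = log 2 (real M)"
        have "l > 0" using True by (simp add: l_def)
        then have "ereal (\<Phi> \<delta>) * (1 - ereal c / ?M) = ereal (\<Phi> \<delta> * (1 - c / l))"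
          using True by (simp add: M log2_enat_def one_ereal_def flip: l_def)
        with bound[OF enat True] M show ?thesis by (simp add: num c_def l_def)
      next
        case False
        with M M1 have "M = 1" by simp
        \<comment> \<open>The denominator is \<open>log 2 1 = 0\<close>, and a positive
          \<open>c\<close> divided by \<open>0\<close> is \<open>\<infinity>\<close> in
          \<open>ereal\<close>.\<close>
        then show ?thesis using c by (intro trivial, unfold num) (simp add: M log2_enat_def)
      qed
    next
      case infinity
      \<comment> \<open>Division by \<open>\<infinity>\<close> gives \<open>0\<close>, so the claim
        reduces to \<open>\<Phi> \<delta>\<close> as a lower bound. It is the limit of the bounds
        from finite packings as \<open>m\<close> tends to infinity.\<close>
      have le: "ereal (\<Phi> \<delta> * (1 - c / log 2 m)) \<le> enn2ereal ?R" if "m \<ge> 2" for m :: nat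
        using bound[OF enat that] by (simp add: infinity c_def)
      have "filterlim (\<lambda>m. ln (real m)) at_top sequentially"
        by (rule filterlim_compose[OF ln_at_top filterlim_real_sequentially])
      then have "(\<lambda>m. c * ln 2 / ln (real m)) \<longlonglongrightarrow> 0"
        by (intro tendsto_divide_0[OF tendsto_const] filterlim_at_top_imp_at_infinity)
      then have "(\<lambda>m. c / log 2 (real m)) \<longlonglongrightarrow> 0"
        by (simp add: log_def)
      then have "(\<lambda>m. \<Phi> \<delta> * (1 - c / log 2 (real m))) \<longlonglongrightarrow> \<Phi> \<delta> * (1 - 0)"
        by (intro tendsto_intros)
      then have "(\<lambda>m. ereal (\<Phi> \<delta> * (1 - c / log 2 (real m)))) \<longlonglongrightarrow> ereal (\<Phi> \<delta>)"
        by simp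
      then have "ereal (\<Phi> \<delta>) \<le> enn2ereal ?R"
        by (rule LIMSEQ_le_const2) (use le in blast)
      then show ?thesis by (simp add: num infinity log2_enat_def)
    qed
  qed
qed

end
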